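(* Let $1<q<3$. The $q$-Gaussian density $g_q$ is the following variance mixture of normal densities: for all $x\in\mathbb{R}$, $$g_q(x)=\int_0^\infty \frac{1}{\sqrt{2\pi}\,v}\exp\left(-\frac{x^2}{2v^2}\right) f_V(v)\,dv,$$ where the mixing measure is the probability measure on $(0,\infty)$ with density $$f_V(v)=C_{V,q}\exp\left(-\frac{1}{2(q-1)v^2}\right)v^{-\frac{2}{q-1}},\quad v>0,$$ with $$C_{V,q}^{-1}=\Gamma\left(\frac{3-q}{2(q-1)}\right)\cdot\frac12\cdot[2(q-1)]^{\frac{3-q}{2(q-1)}}.$$ That is, $g_q$ is the density of $V\cdot Z$, where $V$ has density $f_V$ and $Z$ is a standard normal random variable independent of $V$.
   Context: For $1<q<3$, the $q$-Gaussian density is $$g_q(x)=C_q\,[1-(1-q)x^2]^{1/(1-q)}=C_q\,[1+(q-1)x^2]^{-1/(q-1)},\quad x\in\mathbb{R},$$ with $$C_q^{-1}=\frac{\sqrt{\pi}\,\Gamma\left(\frac{3-q}{2(q-1)}\right)}{\sqrt{q-1}\,\Gamma\left(\frac{1}{q-1}\right)}.$$ *)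

theory Defs
  imports "HOL-Probability.Probability"
begin

definition q_gaussian_const :: "real \<Rightarrow> real" where
  "q_gaussian_const q =
     inverse (sqrt pi * Gamma ((3 - q) / (2 * (q - 1))) / (sqrt (q - 1) * Gamma (1 / (q - 1))))"

definition q_gaussian_density :: "real \<Rightarrow> real \<Rightarrow> real" where
  "q_gaussian_density q x = q_gaussian_const q * (1 - (1 - q) * x\<^sup>2) powr (1 / (1 - q))"

lemma q_gaussian_density_alt:
  "q_gaussian_density q x = q_gaussian_const q * (1 + (q - 1) * x\<^sup>2) powr (- (1 / (q - 1)))"
proof -
  have "1 - (1 - q) * x\<^sup>2 = 1 + (q - 1) * x\<^sup>2"
    by (simp add: algebra_simps)
  moreover have "1 / (1 - q) = - (1 / (q - 1))"
    using minus_divide_right[of 1 "q - 1"] by simp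
  ultimately show ?thesis
    by (simp only: q_gaussian_density_def)
qed

definition mixing_const :: "real \<Rightarrow> real" where
  "mixing_const q =
     inverse (Gamma ((3 - q) / (2 * (q - 1))) * (1 / 2) *
              (2 * (q - 1)) powr ((3 - q) / (2 * (q - 1))))"

text \<open>The density is given on the positive half-line only; it is extended by zero so that it can
  also serve as a density on the whole real line.\<close>

definition mixing_density :: "real \<Rightarrow> real \<Rightarrow> real" where
  "mixing_density q v =
     (if v > 0
      then mixing_const q * exp (- 1 / (2 * (q - 1) * v\<^sup>2)) * v powr (- 2 / (q - 1))
      else 0)"

definition mixing_measure :: "real \<Rightarrow> real measure" where
  "mixing_measure q = density (restrict_space lborel {0<..}) (mixing_density q)"

end

theory Submission
  imports Defs
begin

text \<open>The substitution \<open>t = a / v\<^sup>2\<close> turns \<open>\<integral> exp (- a / v\<^sup>2) v powr - (2 z + 1) dv\<close>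
  into a Gamma integral. With \<open>a = 1 / (2 (q - 1))\<close> this normalises the mixing density; multiplying by
  the Gaussian kernel merely replaces \<open>a\<close> by \<open>a + x\<^sup>2 / 2\<close> and \<open>z\<close> by \<open>z + 1 / 2\<close>, which gives the
  \<open>q\<close>-Gaussian density. The mixture is the density of the product \<open>V Z\<close> by Fubini.\<close>

text \<open>Bridge between the Bochner set integrals, in which the mixture identities are stated,
  and the nonnegative integrals that measure total mass and describe the density of a
  product.\<close>

lemma nn_set_integral_eq_set_integral:
  fixes f :: "'a \<Rightarrow> real"
  assumes "set_integrable M A f" "\<And>x. x \<in> A \<Longrightarrow> 0 \<le> f x"
  shows "(\<integral>\<^sup>+x\<in>A. ennreal (f x) \<partial>M) = ennreal (LINT x:A|M. f x)"
proof -
  have "(\<integral>\<^sup>+x\<in>A. ennreal (f x) \<partial>M) = (\<integral>\<^sup>+x. ennreal (indicator A x *\<^sub>R f x) \<partial>M)"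
    by (intro nn_integral_cong) (simp split: split_indicator)
  also have "\<dots> = ennreal (LINT x:A|M. f x)"
    using assms unfolding set_integrable_def set_lebesgue_integral_def
    by (intro nn_integral_eq_integral) (auto split: split_indicator)
  finally show ?thesis .
qed

text \<open>Under \<open>t = a / v\<^sup>2\<close> the factor \<open>t powr (z - 1)\<close>
  contributes the power -2 (z - 1) of v and the Jacobian the power -3, together -(2 z + 1). The
  powers of a combine to \<open>a powr z\<close>, and the 2 of the Jacobian ends up in the
  denominator.\<close>

lemma inverse_square_Gamma_integral:
  fixes a z :: real
  assumes "a > 0" "z > 0"
  shows "set_integrable lborel {0<..} (\<lambda>v. exp (- a / v\<^sup>2) * v powr (- (2 * z + 1)))" (is ?int)
    and "(LBINT v:{0<..}. exp (- a / v\<^sup>2) * v powr (- (2 * z + 1))) = Gamma z / (2 * a powr z)" (is ?val)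
proof -
  let ?f = "\<lambda>t::real. t powr (z - 1) / exp t"
  let ?g = "\<lambda>v::real. a / v\<^sup>2"
  let ?h = "\<lambda>v::real. exp (- a / v\<^sup>2) * v powr (- (2 * z + 1))"
  have "(?f has_integral Gamma z) {0..}"
    by (rule Gamma_integral_real) fact
  \<comment> \<open>The null set {0} is dropped because the substitution only reaches positive
    t.\<close>
  moreover have "(?f has_integral Gamma z) {0..} = (?f has_integral Gamma z) {0<..}"
    by (intro has_integral_spike_set_eq; rule negligible_subset[of "{0}"]) auto
  \<comment> \<open>Nonnegativity upgrades gauge integrability to the absolute integrability that
    the change of variables works with.\<close>
  ultimately have f: "?f absolutely_integrable_on {0<..}" "integral {0<..} ?f = Gamma z"
    by (auto intro!: nonnegative_absolutely_integrable_1 simp: has_integral_iff)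
  have img: "?g ` {0<..} = {0<..}"
  proof (intro equalityI subsetI)
    fix t :: real assume "t \<in> {0<..}"
    then show "t \<in> ?g ` {0<..}"
      using assms by (intro image_eqI[of _ _ "sqrt (a / t)"]) auto
  qed (use assms in auto)
  have inj: "inj_on ?g {0<..}"
    using assms by (auto intro!: inj_onI simp: field_simps power2_eq_iff)
  have der: "(?g has_field_derivative - 2 * a / v ^ 3) (at v within {0<..})" if "v \<in> {0<..}" for v
    using that by (auto intro!: derivative_eq_intros simp: field_simps power_eq_if)
  have eq: "\<bar>- 2 * a / v ^ 3\<bar> * ?f (?g v) = 2 * a powr z * ?h v" if "v \<in> {0<..}" for v
  proof -
    have v: "v > 0" using that by simp
    have "(a / v\<^sup>2) powr (z - 1) = a powr (z - 1) * v powr (- 2 * (z - 1))"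
      using v assms powr_minus[of v "2 * (z - 1)"]
      by (simp add: powr_divide powr_powr inverse_eq_divide flip: powr_numeral)
    moreover have "a powr z = a * a powr (z - 1)"
      using assms by (simp add: powr_diff)
    moreover have "v powr (- (2 * z + 1)) = v powr (-2 * (z - 1)) / v ^ 3"
    proof -
      have "v powr (- (2 * z + 1)) = v powr (-2 * (z - 1) - 3)" by (simp add: algebra_simps)
      also have "\<dots> = v powr (-2 * (z - 1)) / v ^ 3"
        using v by (subst powr_diff) simp
      finally show ?thesis .
    qed
    ultimately show ?thesis
      using v assms by (simp add: abs_mult exp_minus field_simps)
  qed
  have *: "(\<lambda>v. \<bar>- 2 * a / v ^ 3\<bar> * ?f (?g v)) absolutely_integrable_on {0<..} \<and>
      integral {0<..} (\<lambda>v. \<bar>- 2 * a / v ^ 3\<bar> * ?f (?g v)) = Gamma z"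
    by (subst has_absolute_integral_change_of_variables_1'[OF _ der inj]) (use f img in auto)
  have i: "integral {0<..} (\<lambda>v. 2 * a powr z * ?h v) = Gamma z"
    using conjunct2[OF *] by (simp only: integral_cong[OF eq])
  have "(\<lambda>v. 2 * a powr z * ?h v) absolutely_integrable_on {0<..}"
    by (rule iffD1[OF set_integrable_cong[OF refl refl eq] conjunct1[OF *]])
  \<comment> \<open>Absolute integrability refers to the completion of \<open>lborel\<close>; since
    the integrand is Borel, it descends to \<open>lborel\<close> itself.\<close>
  then have si: "set_integrable lborel {0<..} (\<lambda>v. 2 * a powr z * ?h v)"
    unfolding set_integrable_def by (subst (asm) integrable_completion) auto
  then show int: ?int
    using assms by (simp add: set_integrable_mult_right_iff)
  have "(LBINT v:{0<..}. 2 * a powr z * ?h v) = Gamma z"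
    using set_borel_integral_eq_integral(2)[OF si] i assms by simp
  then show ?val
    using assms by (simp add: field_simps)
qed

text \<open>Given X = v with v nonzero, the product is v Y, whose density at x is g (x / v) / |v|;
  averaging over v with weight f gives h. The condition \<open>f 0 = 0\<close> settles v = 0, where
  this rescaling breaks down.\<close>

lemma (in prob_space) distributed_mult:
  fixes f g h :: "real \<Rightarrow> ennreal"
  assumes indep: "indep_var borel X borel Y"
    and X: "distributed M lborel X f" and Y: "distributed M lborel Y g"
    and f0: "f 0 = 0"
    and h: "\<And>x. h x = (\<integral>\<^sup>+v. f v * (ennreal \<bar>inverse v\<bar> * g (inverse v * x)) \<partial>lborel)"
  shows "distributed M lborel (\<lambda>\<omega>. X \<omega> * Y \<omega>) h"
  unfolding distributed_def
proof safe
  have [measurable]: "f \<in> borel_measurable borel" "g \<in> borel_measurable borel"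
    using distributed_borel_measurable[OF X] distributed_borel_measurable[OF Y] by simp_all
  have [measurable]: "random_variable borel X" "random_variable borel Y"
    using distributed_measurable[OF X] distributed_measurable[OF Y] by simp_all
  have h_eq: "h = (\<lambda>x. \<integral>\<^sup>+v. f v * (ennreal \<bar>inverse v\<bar> * g (inverse v * x)) \<partial>lborel)"
    using h by auto
  show "h \<in> borel_measurable lborel"
    unfolding h_eq by measurable
  then have [measurable]: "h \<in> borel_measurable borel" by simp
  show "random_variable lborel (\<lambda>\<omega>. X \<omega> * Y \<omega>)" by simp
  \<comment> \<open>Independence is stated over \<open>borel\<close>, the densities over
    \<open>lborel\<close>; both have the same sets, so the distributions agree.\<close>
  have "distr M borel X = distr M lborel X" "distr M borel Y = distr M lborel Y"
      "distr M (borel \<Otimes>\<^sub>M borel) (\<lambda>\<omega>. (X \<omega>, Y \<omega>)) = distr M (lborel \<Otimes>\<^sub>M lborel) (\<lambda>\<omega>. (X \<omega>, Y \<omega>))"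
    by (auto intro!: distr_cong sets_pair_measure_cong)
  then have XY: "distributed M (lborel \<Otimes>\<^sub>M lborel) (\<lambda>\<omega>. (X \<omega>, Y \<omega>)) (\<lambda>(x, y). f x * g y)"
    using indep unfolding indep_var_distribution_eq
    by (intro distributed_joint_indep' X Y lborel.sigma_finite_measure_axioms) auto
  show "distr M lborel (\<lambda>\<omega>. X \<omega> * Y \<omega>) = density lborel h"
  proof (rule measure_eqI)
    fix A assume "A \<in> sets (distr M lborel (\<lambda>\<omega>. X \<omega> * Y \<omega>))"
    then have [measurable]: "A \<in> sets borel" by simp
    have "emeasure (distr M lborel (\<lambda>\<omega>. X \<omega> * Y \<omega>)) A = (\<integral>\<^sup>+\<omega>. indicator A (X \<omega> * Y \<omega>) \<partial>M)"
      by (simp add: nn_integral_distr flip: nn_integral_indicator)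
    also have "\<dots> = (\<integral>\<^sup>+p. (case p of (v, y) \<Rightarrow> f v * g y) * indicator A (fst p * snd p) \<partial>(lborel \<Otimes>\<^sub>M lborel))"
      by (subst distributed_nn_integral[OF XY]) (auto simp: borel_prod)
    also have "\<dots> = (\<integral>\<^sup>+v. \<integral>\<^sup>+y. f v * g y * indicator A (v * y) \<partial>lborel \<partial>lborel)"
      by (subst lborel.nn_integral_fst[symmetric]) (auto simp: borel_prod split_beta')
    \<comment> \<open>For each fixed v, the inner integral is rescaled by x = v y.\<close>
    also have "\<dots> = (\<integral>\<^sup>+v. \<integral>\<^sup>+x. f v * (ennreal \<bar>inverse v\<bar> * g (inverse v * x)) * indicator A x \<partial>lborel \<partial>lborel)"
    proof (rule nn_integral_cong)
      fix v :: real
      show "(\<integral>\<^sup>+y. f v * g y * indicator A (v * y) \<partial>lborel) =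
          (\<integral>\<^sup>+x. f v * (ennreal \<bar>inverse v\<bar> * g (inverse v * x)) * indicator A x \<partial>lborel)"
      proof (cases "v \<noteq> 0")
        case True
        then have "(\<integral>\<^sup>+y. f v * g y * indicator A (v * y) \<partial>lborel) =
            ennreal \<bar>inverse v\<bar> * (\<integral>\<^sup>+x. f v * g (0 + inverse v * x) * indicator A (v * (0 + inverse v * x)) \<partial>lborel)"
          by (intro nn_integral_real_affine) auto
        also have "\<dots> = (\<integral>\<^sup>+x. ennreal \<bar>inverse v\<bar> * (f v * g (inverse v * x) * indicator A x) \<partial>lborel)"
          using True by (subst nn_integral_cmult) (auto simp flip: mult.assoc)
        finally show ?thesis by (simp add: ac_simps)
      qed (simp add: f0)
    qed
    also have "\<dots> = (\<integral>\<^sup>+x. \<integral>\<^sup>+v. f v * (ennreal \<bar>inverse v\<bar> * g (inverse v * x)) * indicator A x \<partial>lborel \<partial>lborel)"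
      by (rule lborel_pair.Fubini') measurable
    also have "\<dots> = emeasure (density lborel h) A"
      by (simp add: emeasure_density h_eq nn_integral_multc)
    finally show "emeasure (distr M lborel (\<lambda>\<omega>. X \<omega> * Y \<omega>)) A = emeasure (density lborel h) A" .
  qed simp
qed

lemma mixing_const_pos:
  assumes "1 < q" "q < 3"
  shows "mixing_const q > 0"
  using assms by (auto simp: mixing_const_def intro!: Gamma_real_pos mult_pos_pos)

lemma mixing_density_nonneg:
  assumes "1 < q" "q < 3"
  shows "0 \<le> mixing_density q v"
  using mixing_const_pos[OF assms] by (simp add: mixing_density_def)

lemma measurable_mixing_density [measurable]: "mixing_density q \<in> borel_measurable borel"
  unfolding mixing_density_def by measurable

lemma mixing_density_integral:
  assumes "1 < q" "q < 3"
  shows "set_integrable lborel {0<..} (mixing_density q)"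
    and "(LBINT v:{0<..}. mixing_density q v) = 1"
proof -
  \<comment> \<open>These values are read off from the mixing density: a from its exponential, and z
    from 2 z + 1 = 2 / (q - 1). Given q > 1, the bound q < 3 is exactly z > 0.\<close>
  define a z where "a = 1 / (2 * (q - 1))" and "z = (3 - q) / (2 * (q - 1))"
  let ?f = "\<lambda>v. exp (- a / v\<^sup>2) * v powr (- (2 * z + 1))"
  have az: "a > 0" "z > 0" using assms by (auto simp: a_def z_def)
  have c: "mixing_const q = 2 / (Gamma z * (2 * (q - 1)) powr z)"
    unfolding mixing_const_def z_def[symmetric] by (simp add: inverse_eq_divide)
  have z: "- (2 * z + 1) = - 2 / (q - 1)"
    using assms by (simp add: z_def field_simps)
  have eq: "mixing_density q v = mixing_const q * ?f v" if "v \<in> {0<..}" for v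
    using that assms unfolding z by (simp add: mixing_density_def a_def)
  show "set_integrable lborel {0<..} (mixing_density q)"
    using inverse_square_Gamma_integral(1)[OF az]
    by (subst set_integrable_cong[OF refl refl eq]) auto
  have "(LBINT v:{0<..}. mixing_density q v) = mixing_const q * (LBINT v:{0<..}. ?f v)"
    by (subst set_lebesgue_integral_cong[OF _ allI[OF impI[OF eq]]]) auto
  also have "\<dots> = mixing_const q * (Gamma z / (2 * a powr z))"
    by (simp only: inverse_square_Gamma_integral(2)[OF az])
  also have "a powr z = inverse ((2 * (q - 1)) powr z)"
    using assms by (simp add: a_def powr_divide field_simps)
  also have "mixing_const q * (Gamma z / (2 * inverse ((2 * (q - 1)) powr z))) = 1"
    using Gamma_real_pos[OF az(2)] assms
    by (simp add: c)
  finally show "(LBINT v:{0<..}. mixing_density q v) = 1" .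
qed

lemma q_gaussian_mixture:
  assumes "1 < q" "q < 3"
  defines "k \<equiv> \<lambda>x v. 1 / (sqrt (2 * pi) * v) * exp (- x\<^sup>2 / (2 * v\<^sup>2)) * mixing_density q v"
  shows "set_integrable lborel {0<..} (k x)"
    and "(LBINT v:{0<..}. k x v) = q_gaussian_density q x"
proof -
  \<comment> \<open>The factor 1 / v of the kernel raises the exponent from 2 p = 2 z + 1 to 2 p +
    1, so the Gamma parameter becomes p. In the exponential, 1 / b + \<open>x\<^sup>2 / 2\<close>
    equals u / b, where u is the base of the power in the q-Gaussian.\<close>
  define p where "p = 1 / (q - 1)"
  define b where "b = 2 * (q - 1)"
  define z where "z = (3 - q) / b"
  define u where "u = 1 + (q - 1) * x\<^sup>2"
  let ?f = "\<lambda>v. exp (- (u / b) / v\<^sup>2) * v powr (- (2 * p + 1))"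
  let ?c = "mixing_const q / sqrt (2 * pi)"
  have u: "u > 0" using assms by (auto simp: u_def intro!: add_pos_nonneg)
  have b: "b > 0" and p: "p > 0" using assms by (auto simp: p_def b_def)
  then have ub: "u / b > 0" using u by simp
  have z: "p = z + 1 / 2" using assms by (simp add: p_def z_def b_def field_simps)
  have eq: "k x v = ?c * ?f v" if "v \<in> {0<..}" for v
  proof -
    have v: "v > 0" using that by simp
    have "v powr (- (2 * p + 1)) = v powr (- 2 / (q - 1)) / v"
      using v by (simp add: p_def powr_diff powr_minus field_simps powr_add)
    moreover have "exp (- (u / b) / v\<^sup>2) = exp (- x\<^sup>2 / (2 * v\<^sup>2)) * exp (- 1 / (2 * (q - 1) * v\<^sup>2))"
      using v assms by (simp add: u_def b_def field_simps flip: exp_add)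
    ultimately show ?thesis
      using v by (simp add: k_def mixing_density_def)
  qed
  show "set_integrable lborel {0<..} (k x)"
    using inverse_square_Gamma_integral(1)[OF ub p]
    by (subst set_integrable_cong[OF refl refl eq]) auto
  have "(LBINT v:{0<..}. k x v) = ?c * (LBINT v:{0<..}. ?f v)"
    by (subst set_lebesgue_integral_cong[OF _ allI[OF impI[OF eq]]]) auto
  also have "\<dots> = ?c * (Gamma p / (2 * (u / b) powr p))"
    by (simp only: inverse_square_Gamma_integral(2)[OF ub p])
  \<comment> \<open>Splitting p = z + 1/2 isolates \<open>b powr z\<close>, which cancels against
    the mixing constant and leaves \<open>sqrt b\<close>.\<close>
  also have "(u / b) powr p = u powr p / (b powr z * sqrt b)"
    using u b by (simp add: powr_divide z powr_add powr_half_sqrt)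
  also have "mixing_const q = 2 / (Gamma z * b powr z)"
    unfolding mixing_const_def b_def[symmetric] z_def[symmetric] by (simp add: inverse_eq_divide)
  also have "2 / (Gamma z * b powr z) / sqrt (2 * pi) * (Gamma p / (2 * (u powr p / (b powr z * sqrt b)))) =
      Gamma p * sqrt b / (sqrt (2 * pi) * Gamma z) * u powr - p"
    using b by (simp add: powr_minus field_simps)
  \<comment> \<open>The factor \<open>sqrt 2\<close> cancels the one in
    \<open>sqrt (2 * pi)\<close>, which leaves the q-Gaussian constant.\<close>
  also have sqrt_b: "sqrt b = sqrt 2 * sqrt (q - 1)"
    by (simp only: b_def real_sqrt_mult)
  also have "Gamma p * (sqrt 2 * sqrt (q - 1)) / (sqrt (2 * pi) * Gamma z) * u powr - p = q_gaussian_density q x"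
    unfolding q_gaussian_density_alt q_gaussian_const_def
      b_def[symmetric] z_def[symmetric] p_def[symmetric] u_def[symmetric]
    by (simp add: real_sqrt_mult field_simps)
  finally show "(LBINT v:{0<..}. k x v) = q_gaussian_density q x" .
qed

theorem theorem2p2:
  fixes q :: real
  assumes "1 < q" and "q < 3"
  shows "(\<forall>v. 0 \<le> mixing_density q v) \<and>
    prob_space (mixing_measure q) \<and>
    (\<forall>x::real.
       set_integrable lborel {0<..}
         (\<lambda>v. 1 / (sqrt (2 * pi) * v) * exp (- x\<^sup>2 / (2 * v\<^sup>2)) * mixing_density q v) \<and>
       q_gaussian_density q x =
         (LBINT v:{0<..}.
            1 / (sqrt (2 * pi) * v) * exp (- x\<^sup>2 / (2 * v\<^sup>2)) * mixing_density q v)) \<and>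
    (\<forall>(M :: 'a measure) V Z.
       prob_space M \<longrightarrow>
       distributed M lborel V (mixing_density q) \<longrightarrow>
       distributed M lborel Z std_normal_density \<longrightarrow>
       prob_space.indep_var M borel V borel Z \<longrightarrow>
       distributed M lborel (\<lambda>\<omega>. V \<omega> * Z \<omega>) (q_gaussian_density q))"
proof (intro conjI allI impI)
  show "0 \<le> mixing_density q v" for v
    using assms by (rule mixing_density_nonneg)
next
  show "prob_space (mixing_measure q)"
  proof
    \<comment> \<open>The restricted space is traded for an indicator over the whole line, so that
      the normalisation integral applies.\<close>
    have "emeasure (mixing_measure q) (space (mixing_measure q)) =
        (\<integral>\<^sup>+v. ennreal (mixing_density q v) * indicator {0<..} v \<partial>lborel)"
      by (auto simp: mixing_measure_def emeasure_density nn_integral_restrict_space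
          space_restrict_space sets_restrict_space_iff measurable_restrict_space1
          intro!: nn_integral_cong split: split_indicator)
    also have "\<dots> = ennreal (LBINT v:{0<..}. mixing_density q v)"
      using mixing_density_integral(1)[OF assms] mixing_density_nonneg[OF assms]
      by (intro nn_set_integral_eq_set_integral) auto
    finally show "emeasure (mixing_measure q) (space (mixing_measure q)) = 1"
      using mixing_density_integral(2)[OF assms] by simp
  qed
next
  fix x
  show "set_integrable lborel {0<..}
      (\<lambda>v. 1 / (sqrt (2 * pi) * v) * exp (- x\<^sup>2 / (2 * v\<^sup>2)) * mixing_density q v)"
    and "q_gaussian_density q x = (LBINT v:{0<..}.
      1 / (sqrt (2 * pi) * v) * exp (- x\<^sup>2 / (2 * v\<^sup>2)) * mixing_density q v)"
    using q_gaussian_mixture[OF assms] by simp_all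
next
  fix M :: "'a measure" and V Z
  assume M: "prob_space M" and V: "distributed M lborel V (mixing_density q)"
    and Z: "distributed M lborel Z std_normal_density"
    and indep: "prob_space.indep_var M borel V borel Z"
  let ?k = "\<lambda>x v. 1 / (sqrt (2 * pi) * v) * exp (- x\<^sup>2 / (2 * v\<^sup>2)) * mixing_density q v"
  show "distributed M lborel (\<lambda>\<omega>. V \<omega> * Z \<omega>) (q_gaussian_density q)"
  proof (rule prob_space.distributed_mult[OF M indep V Z])
    fix x :: real
    have "ennreal (q_gaussian_density q x) = ennreal (LBINT v:{0<..}. ?k x v)"
      by (simp only: q_gaussian_mixture(2)[OF assms])
    also have "\<dots> = (\<integral>\<^sup>+v. ennreal (?k x v) * indicator {0<..} v \<partial>lborel)"
      using q_gaussian_mixture(1)[OF assms] mixing_density_nonneg[OF assms]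
      by (intro nn_set_integral_eq_set_integral[symmetric]) auto
    also have "\<dots> = (\<integral>\<^sup>+v. ennreal (mixing_density q v) *
        (ennreal \<bar>inverse v\<bar> * ennreal (std_normal_density (inverse v * x))) \<partial>lborel)"
    proof (rule nn_integral_cong)
      fix v :: real
      show "ennreal (?k x v) * indicator {0<..} v = ennreal (mixing_density q v) *
        (ennreal \<bar>inverse v\<bar> * ennreal (std_normal_density (inverse v * x)))"
      \<comment> \<open>For v > 0 the kernel is the standard normal density rescaled by v. Elsewhere
        both sides vanish, the mixing density being extended by zero.\<close>
      proof (cases "v > 0")
        case True
        then have "?k x v = mixing_density q v * (\<bar>inverse v\<bar> * std_normal_density (inverse v * x))"
          by (simp add: std_normal_density_def field_simps)
        then show ?thesis
          using True mixing_density_nonneg[OF assms] by (simp add: ennreal_mult)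
      qed (simp add: mixing_density_def)
    qed
    finally show "ennreal (q_gaussian_density q x) = (\<integral>\<^sup>+v. ennreal (mixing_density q v) *
        (ennreal \<bar>inverse v\<bar> * ennreal (std_normal_density (inverse v * x))) \<partial>lborel)" .
  \<comment> \<open>What remains is that the density of V vanishes at 0.\<close>
  qed (simp add: mixing_density_def)
qed
end
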